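(* Let $0<p<1$, $q=1-p$, $X\sim\operatorname{Bin}(N,p)$, and let $Np\in\mathbb Z$, so that $h_N=\lceil Np\rceil-Np=0$. With $$a_k(h;p)=\frac{(-1)^{k+1}}{k(k+1)}\Bigl[B_{k+1}-\bigl(p^{-k}+(-1)^{k+1}q^{-k}\bigr)B_{k+1}(h)\Bigr],\qquad k\ge1,$$ the coefficients of the logarithmic expansion $\log\frac{\mathbb E|X-Np|}{\sqrt{2Npq/\pi}}\sim\sum_{k\ge1}a_k(h_N;p)N^{-k}$, every even-order coefficient vanishes, $a_2(0;p)=a_4(0;p)=\dots=0$, and, as $N\to\infty$ through integers with $Np\in\mathbb Z$, $$\log\frac{\mathbb E|X-Np|}{\sqrt{2Npq/\pi}}\sim\sum_{j\ge1}\frac{a_{2j-1}(0;p)}{N^{2j-1}},\qquad a_{2j-1}(0;p)=\frac{B_{2j}}{(2j-1)\,2j}\Bigl[1-\bigl(p^{1-2j}+q^{1-2j}\bigr)\Bigr].$$ These coefficients alternate strictly in sign: $$(-1)^{j}\,a_{2j-1}(0;p)>0\qquad(j\ge1,\ 0<p<1).$$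
   Context: $B_k(t)$ are the Bernoulli polynomials, $\frac{z e^{tz}}{e^z-1}=\sum_{k\ge0}B_k(t)\frac{z^k}{k!}$, and $B_k=B_k(0)$ the Bernoulli numbers. $\operatorname{Bin}(N,p)$ is the binomial distribution. The symbol $\sim$ denotes a complete asymptotic expansion: for every fixed $M$, truncating the series after the terms of order $N^{-M}$ leaves an error $O(N^{-M-1})$. *)

theory Defs
  imports
    "HOL-Probability.Probability"
    "HOL-Library.Landau_Symbols"
    "HOL-Computational_Algebra.Formal_Power_Series"
begin

text \<open>The generating function \<open>z e\<^sup>t\<^sup>z / (e\<^sup>z - 1)\<close> is read as a quotient of formal power series
  in \<open>z\<close>; the division is exact, as \<open>bernpoly_generating_function\<close> confirms.\<close>

definition bernpoly :: "nat \<Rightarrow> real \<Rightarrow> real" where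
  "bernpoly k t = fact k * fps_nth (fps_X * fps_exp t / (fps_exp 1 - 1)) k"

definition bernoulli_num :: "nat \<Rightarrow> real" where
  "bernoulli_num k = bernpoly k 0"

lemma bernpoly_generating_function:
  "Abs_fps (\<lambda>k. bernpoly k t / fact k) * (fps_exp 1 - 1) = fps_X * fps_exp t"
proof -
  let ?g = "fps_exp 1 - 1 :: real fps"
  have nth: "fps_nth ?g 0 = 0" "fps_nth ?g 1 = 1"
    by simp_all
  then have "?g \<noteq> 0" by (metis fps_zero_nth zero_neq_one)
  have "subdegree ?g = 1"
    using nth by (intro subdegreeI) auto
  moreover have "subdegree (fps_X * fps_exp t) = 1"
    by (intro subdegreeI) auto
  moreover have "fps_X * fps_exp t \<noteq> 0"
    by (simp add: fps_eq_iff exI[of _ 1])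
  ultimately have "?g dvd fps_X * fps_exp t"
    using \<open>?g \<noteq> 0\<close> by (simp add: fps_dvd_iff)
  moreover have "Abs_fps (\<lambda>k. bernpoly k t / fact k) = fps_X * fps_exp t / ?g"
    by (simp add: bernpoly_def fps_eq_iff)
  ultimately show ?thesis
    by simp
qed

definition log_coeff :: "nat \<Rightarrow> real \<Rightarrow> real \<Rightarrow> real" where
  "log_coeff k h p = (-1) ^ (k + 1) / (real k * real (k + 1)) *
     (bernoulli_num (k + 1)
       - (p powi (- int k) + (-1) ^ (k + 1) * (1 - p) powi (- int k)) * bernpoly (k + 1) h)"

definition lattice_offset :: "nat \<Rightarrow> real \<Rightarrow> real" where
  "lattice_offset N p = real_of_int \<lceil>real N * p\<rceil> - real N * p"

definition binomial_mad :: "nat \<Rightarrow> real \<Rightarrow> real" where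
  "binomial_mad N p = measure_pmf.expectation (binomial_pmf N p) (\<lambda>x. \<bar>real x - real N * p\<bar>)"

definition log_mad_ratio :: "nat \<Rightarrow> real \<Rightarrow> real" where
  "log_mad_ratio N p = ln (binomial_mad N p / sqrt (2 * real N * p * (1 - p) / pi))"

text \<open>Complete asymptotic expansion \<open>f(N) \<sim> \<Sum>\<^sub>i\<^sub>\<ge>\<^sub>1 c\<^sub>i(N) N\<^bsup>-e(i)\<^esup>\<close> along the filter \<open>F\<close>: the
  truncation at \<open>M\<close> keeps the terms with \<open>e(i) \<le> M\<close>. The coefficients may depend on \<open>N\<close> (as they
  do through the lattice offset), and the exponents \<open>e\<close> need to be injective on \<open>{1..}\<close> (so that
  only finitely many terms are kept).\<close>

definition asymp_expansion ::
  "nat filter \<Rightarrow> (nat \<Rightarrow> real) \<Rightarrow> (nat \<Rightarrow> nat \<Rightarrow> real) \<Rightarrow> (nat \<Rightarrow> nat) \<Rightarrow> bool" where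
  "asymp_expansion F f c e \<longleftrightarrow>
     (\<forall>M. (\<lambda>N. f N - (\<Sum>i | 1 \<le> i \<and> e i \<le> M. c N i / real N ^ e i))
            \<in> O[F](\<lambda>N. 1 / real N ^ (M + 1)))"

text \<open>\<open>N \<rightarrow> \<infinity>\<close> through the integers with \<open>Np \<in> \<int>\<close>. For irrational \<open>p\<close> this is the trivial filter.\<close>

definition lattice_sequentially :: "real \<Rightarrow> nat filter" where
  "lattice_sequentially p = inf sequentially (principal {N. real N * p \<in> \<int>})"

end

theory Submission
  imports Defs "HOL-Real_Asymp.Real_Asymp"
begin

text \<open>When \<open>m = Np\<close> is an integer, \<open>(Np - k) P(X = k)\<close> telescopes in \<open>k\<close> and the mean absolute
  deviation is \<open>2mq P(X = m)\<close>. In the logarithm all the main terms of Stirling's formula cancel, so that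
  the log ratio is exactly \<open>r(N) - r(Np) - r(Nq)\<close> with \<open>r\<close> the Stirling remainder, and the expansion is
  read off from the Stirling series. The latter comes from one Euler-Maclaurin step on
  \<open>[n, n + 1]\<close>: the derivative of \<open>\<Sum>\<^sub>k\<^sub>\<le>\<^sub>M (-1)\<^sup>k B\<^sub>k(t) f\<^sub>k(n + t) / k!\<close>, with
  \<open>f\<^sub>k\<^sub>+\<^sub>1\<close> the derivative of \<open>f\<^sub>k\<close>, telescopes to its last term, and the mean value theorem bounds it. The
  signs of the Bernoulli numbers follow from a quadratic recurrence.\<close>

section \<open>Bernoulli numbers and polynomials\<close>

definition bern_fps :: "real \<Rightarrow> real fps" where
  "bern_fps t = Abs_fps (\<lambda>k. bernpoly k t / fact k)"

text \<open>Real power series have no zero divisors, so the factor \<open>fps_exp 1 - 1\<close>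
  cancels. Identities between generating functions can then be checked after multiplying by it,
  without any division.\<close>

lemma bern_fps_eqI:
  assumes "F * (fps_exp 1 - 1) = fps_X * fps_exp t"
  shows "bern_fps t = F"
proof -
  have "fps_nth (fps_exp 1 - 1 :: real fps) 1 \<noteq> 0" by simp
  then have "fps_exp 1 - 1 \<noteq> (0 :: real fps)" by (metis fps_zero_nth)
  then show ?thesis
    using assms bernpoly_generating_function[of t] unfolding bern_fps_def
    by (metis mult_right_cancel)
qed

lemma bern_fps_0: "bern_fps 0 * (fps_exp 1 - 1) = fps_X"
  using bernpoly_generating_function[of 0] by (simp add: bern_fps_def)

lemma bern_fps_shift: "bern_fps t = bern_fps 0 * fps_exp t"
  by (rule bern_fps_eqI) (metis bern_fps_0 mult.assoc mult.commute)

lemma bern_fps_1: "bern_fps 1 = bern_fps 0 + fps_X"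
proof (rule bern_fps_eqI)
  have "(bern_fps 0 + fps_X) * (fps_exp 1 - 1) = bern_fps 0 * (fps_exp 1 - 1) + fps_X * (fps_exp 1 - 1)"
    by (simp add: algebra_simps)
  then show "(bern_fps 0 + fps_X) * (fps_exp 1 - 1) = fps_X * fps_exp 1"
    unfolding bern_fps_0 by (simp add: algebra_simps)
qed

lemma bernpoly_sum:
  "bernpoly n t = fact n * (\<Sum>i\<le>n. bernoulli_num i / fact i * (t ^ (n - i) / fact (n - i)))"
proof -
  have "fps_nth (bern_fps t) n = (\<Sum>i\<le>n. fps_nth (bern_fps 0) i * (t ^ (n - i) / fact (n - i)))"
    by (subst bern_fps_shift) (simp add: fps_mult_nth atLeast0AtMost)
  then show ?thesis by (simp add: bern_fps_def bernoulli_num_def field_simps)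
qed

lemma bernpoly_0 [simp]: "bernpoly 0 t = 1"
proof -
  have "fps_nth (bern_fps 0 * (fps_exp 1 - 1)) 1 = 1"
    by (subst bern_fps_0) simp
  then have "bernoulli_num 0 = 1"
    by (simp add: fps_mult_nth bern_fps_def bernoulli_num_def)
  then show ?thesis using bernpoly_sum[of 0 t] by simp
qed

text \<open>Away from \<open>n = 1\<close> the two endpoint values agree, so the Euler-Maclaurin
  boundary terms become differences of a single function. The exception at \<open>n = 1\<close>
  yields the term \<open>ln x / 2\<close> of Stirling's formula.\<close>

lemma bernpoly_1_eq: "bernpoly n 1 = bernoulli_num n + (if n = 1 then 1 else 0)"
proof -
  have "fps_nth (bern_fps 1) n = fps_nth (bern_fps 0) n + (if n = 1 then 1 else 0)"
    by (simp add: bern_fps_1)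
  then show ?thesis by (auto simp: bern_fps_def bernoulli_num_def field_simps split: if_splits)
qed

lemma has_real_derivative_bernpoly:
  "(bernpoly (Suc n) has_real_derivative real (Suc n) * bernpoly n t) (at t)"
proof -
  have *: "((\<lambda>t. t ^ (Suc n - i) / fact (Suc n - i)) has_real_derivative t ^ (n - i) / fact (n - i)) (at t)"
    if "i \<le> n" for i
  proof -
    have "((\<lambda>t. t ^ Suc k / fact (Suc k)) has_real_derivative (real (Suc k) * t ^ k) / fact (Suc k)) (at t)" for k
      using DERIV_cdivide[OF DERIV_pow[of "Suc k" t UNIV], of "fact (Suc k)"] by simp
    then have "((\<lambda>t. t ^ Suc k / fact (Suc k)) has_real_derivative t ^ k / fact k) (at t)" for k
      by (simp add: fact_Suc del: of_nat_Suc power_Suc)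
    then show ?thesis using that by (metis Suc_diff_le)
  qed
  have "((\<lambda>t. \<Sum>i\<le>n. bernoulli_num i / fact i * (t ^ (Suc n - i) / fact (Suc n - i)))
      has_real_derivative (\<Sum>i\<le>n. bernoulli_num i / fact i * (t ^ (n - i) / fact (n - i)))) (at t)"
    by (intro DERIV_sum DERIV_cmult *) auto
  \<comment> \<open>The summand with \<open>i = Suc n\<close> is constant in \<open>t\<close>. It is
    kept apart because the exponent in its derivative would be the truncated
    \<open>n - Suc n\<close>.\<close>
  then have "((\<lambda>t. fact (Suc n) * ((\<Sum>i\<le>n. bernoulli_num i / fact i * (t ^ (Suc n - i) / fact (Suc n - i)))
        + bernoulli_num (Suc n) / fact (Suc n)))
      has_real_derivative fact (Suc n) * ((\<Sum>i\<le>n. bernoulli_num i / fact i * (t ^ (n - i) / fact (n - i))) + 0)) (at t)"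
    by (intro DERIV_cmult DERIV_add DERIV_const)
  then show ?thesis
    unfolding bernpoly_sum[abs_def] by (simp add: algebra_simps)
qed

lemma continuous_on_bernpoly: "continuous_on S (bernpoly n)"
  unfolding bernpoly_sum[abs_def] by (intro continuous_intros) auto

text \<open>The ODE \<open>X A' = A - X A - A\<^sup>2\<close> of \<open>A = X / (e\<^sup>X - 1)\<close> becomes this after the
  shift by \<open>X / 2\<close> that removes the only nonzero odd coefficient.\<close>

lemma bern_fps_ode:
  defines "E \<equiv> bern_fps 0 + fps_const (1 / 2) * fps_X"
  shows "fps_X * fps_deriv E = E - E * E + fps_const (1 / 4) * fps_X ^ 2"
proof -
  define A where "A = bern_fps 0"
  define e where "e = fps_exp (1 :: real)"
  have 1: "A * (e - 1) = fps_X" using bern_fps_0 by (simp add: A_def e_def)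
  have "fps_deriv (A * (e - 1)) = fps_deriv A * (e - 1) + A * e"
    by (simp add: e_def)
  then have "fps_deriv A * (e - 1) + A * e = 1" by (simp add: 1)
  \<comment> \<open>Multiplying by \<open>A\<close> makes \<open>e\<close> occur only in the product
    \<open>A * (e - 1)\<close>, which equals \<open>fps_X\<close>; this eliminates the
    exponential.\<close>
  then have "A * (fps_deriv A * (e - 1) + A * e) = A" by simp
  moreover have "A * (fps_deriv A * (e - 1) + A * e) = fps_deriv A * (A * (e - 1)) + A * (A * (e - 1)) + A * A"
    by (simp add: algebra_simps)
  ultimately have 2: "fps_X * fps_deriv A = A - fps_X * A - A * A"
    unfolding 1 by (simp add: algebra_simps)
  define c where "c = fps_const (1 / 2 :: real)"
  have c2: "fps_const (1 / 4 :: real) = c * c" and c1: "c + c = 1" by (simp_all add: c_def)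
  have d: "fps_deriv E = fps_deriv A + c" by (simp add: E_def A_def c_def)
  have "fps_X * fps_deriv E = A - fps_X * A - A * A + fps_X * c"
    by (simp add: d distrib_left 2)
  \<comment> \<open>The square is completed for a symbolic \<open>c\<close>. The defect is a
    multiple of \<open>c + c - 1\<close>, which vanishes for \<open>c = 1 / 2\<close>.\<close>
  also have "\<dots> = (A + c * fps_X) - (A + c * fps_X) * (A + c * fps_X) + c * c * fps_X ^ 2
      + (c + c - 1) * (A * fps_X)"
    by (simp add: algebra_simps power2_eq_square)
  also have "(c + c - 1) * (A * fps_X) = 0" by (simp only: c1) simp
  also have "A + c * fps_X = E" by (simp only: E_def A_def c_def)
  finally show ?thesis by (simp only: c2 add_0_right)
qed

text \<open>Coefficients of the differential equation are compared. Since
  \<open>fps_nth E 0 = 1\<close>, the two extreme terms of the convolution contribute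
  \<open>2 * fps_nth E n\<close>; moving them to the left produces the factor
  \<open>n + 1\<close>.\<close>

lemma bern_fps_recurrence:
  defines "E \<equiv> bern_fps 0 + fps_const (1 / 2) * fps_X"
  assumes "0 < n"
  shows "(real n + 1) * fps_nth E n = (if n = 2 then 1 / 4 else 0) - (\<Sum>i=1..<n. fps_nth E i * fps_nth E (n - i))"
proof -
  have E0: "fps_nth E 0 = 1" by (simp add: E_def bern_fps_def)
  have "fps_nth (fps_X * fps_deriv E) n = real n * fps_nth E n"
    using assms(2) by (cases n) auto
  moreover have "fps_nth (fps_X * fps_deriv E) n = fps_nth (E - E * E + fps_const (1 / 4) * fps_X ^ 2) n"
    by (simp only: E_def bern_fps_ode)
  moreover have "fps_nth (fps_const (1 / 4) * fps_X ^ 2) n = (if n = 2 then 1 / 4 else 0 :: real)"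
    by (simp add: fps_X_power_nth)
  ultimately have "real n * fps_nth E n = fps_nth E n - fps_nth (E * E) n + (if n = 2 then 1 / 4 else 0)"
    by (simp only: fps_add_nth fps_sub_nth)
  moreover have "fps_nth (E * E) n = 2 * fps_nth E n + (\<Sum>i=1..<n. fps_nth E i * fps_nth E (n - i))"
  proof -
    have "{0..n} = insert 0 (insert n {1..<n})" using assms(2) by auto
    then show ?thesis using assms(2) by (simp add: fps_mult_nth E0)
  qed
  ultimately show ?thesis by (simp add: algebra_simps)
qed

text \<open>Strong induction on the recurrence. For odd \<open>n\<close> each product has a factor
  of odd index, hence is zero. For even \<open>n\<close> the sign \<open>(-1) ^ (n div 2)\<close>
  splits over the two even indices, so all signed products are nonnegative, and the minus sign in
  front of the sum decides.\<close>

lemma bernoulli_num_parity_sign: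
  defines "E \<equiv> bern_fps 0 + fps_const (1 / 2) * fps_X"
  shows "(odd n \<longrightarrow> fps_nth E n = 0) \<and> (even n \<and> 0 < n \<longrightarrow> (-1) ^ (n div 2) * fps_nth E n < 0)"
proof (induction n rule: less_induct)
  case (less n)
  have rec: "(real n + 1) * fps_nth E n = (if n = 2 then 1 / 4 else 0) - (\<Sum>i=1..<n. fps_nth E i * fps_nth E (n - i))"
    if "0 < n" using bern_fps_recurrence[OF that] by (simp add: E_def)
  show ?case
  proof (intro conjI impI)
    assume n: "odd n"
    have "fps_nth E i * fps_nth E (n - i) = 0" if "i \<in> {1..<n}" for i
      using less[of i] less[of "n - i"] that n by (cases "even i") auto
    then have "(\<Sum>i=1..<n. fps_nth E i * fps_nth E (n - i)) = 0"
      by (rule sum.neutral[rule_format])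
    moreover have "0 < n" "n \<noteq> 2" using n by (auto intro: odd_pos)
    ultimately have "(real n + 1) * fps_nth E n = 0"
      using rec by simp
    then show "fps_nth E n = 0" by (simp add: add_eq_0_iff)
  next
    assume n: "even n \<and> 0 < n"
    have "0 < (-1) ^ (n div 2) * (\<Sum>i=1..<n. fps_nth E i * fps_nth E (n - i))" if "n \<noteq> 2"
    proof -
      have pos: "0 < (-1) ^ (n div 2) * (fps_nth E i * fps_nth E (n - i))"
        if i: "even i" "i \<in> {1..<n}" for i
      proof -
        have "n div 2 = i div 2 + (n - i) div 2" using i n by (auto elim!: evenE)
        then have "(-1) ^ (n div 2) * (fps_nth E i * fps_nth E (n - i))
          = ((-1) ^ (i div 2) * fps_nth E i) * ((-1) ^ ((n - i) div 2) * fps_nth E (n - i))"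
          by (simp add: power_add)
        moreover have "(-1) ^ (i div 2) * fps_nth E i < 0" "(-1) ^ ((n - i) div 2) * fps_nth E (n - i) < 0"
          using less[of i] less[of "n - i"] i n by auto
        ultimately show ?thesis by (metis mult_neg_neg)
      qed
      have "0 \<le> (-1) ^ (n div 2) * (fps_nth E i * fps_nth E (n - i))" if "i \<in> {1..<n}" for i
        using pos[of i] less[of i] that by (cases "even i") auto
      \<comment> \<open>An even \<open>n\<close> other than 2 is at least 4, so index 2 supplies a
        strictly positive term. For \<open>n = 2\<close> the sign comes from the inhomogeneous term
        \<open>1 / 4\<close> instead.\<close>
      moreover have "2 \<in> {1..<n}" using n that by (auto elim!: evenE)
      ultimately show ?thesis
        unfolding sum_distrib_left by (intro sum_pos2[of _ 2] pos) auto
    qed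
    moreover have "n = 2 \<Longrightarrow> (\<Sum>i=1..<n. fps_nth E i * fps_nth E (n - i)) = 0"
      using less[of 1] by (simp add: numeral_2_eq_2)
    ultimately have "(-1) ^ (n div 2) * ((real n + 1) * fps_nth E n) < 0"
      using rec n by (cases "n = 2") (simp_all add: right_diff_distrib)
    then have "(real n + 1) * ((-1) ^ (n div 2) * fps_nth E n) < 0" by (simp add: algebra_simps)
    then show "(-1) ^ (n div 2) * fps_nth E n < 0"
      by (simp add: mult_less_0_iff)
  qed
qed

lemma bernoulli_num_1: "bernoulli_num 1 = - 1 / 2"
  using bernoulli_num_parity_sign[of 1] by (simp add: bern_fps_def bernoulli_num_def)

lemma bernoulli_num_odd:
  assumes "odd n" "n \<noteq> 1" shows "bernoulli_num n = 0"
proof -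
  have "fps_nth (fps_const (1 / 2 :: real)) (n - 1) = 0" using assms by (cases n) auto
  then show ?thesis
    using bernoulli_num_parity_sign[of n] assms by (simp add: bern_fps_def bernoulli_num_def split: if_splits)
qed

lemma bernoulli_num_even_sign:
  assumes "0 < j" shows "(-1) ^ j * bernoulli_num (2 * j) < 0"
proof -
  have "(-1) ^ j * bernoulli_num (2 * j) / fact (2 * j) < 0"
    using bernoulli_num_parity_sign[of "2 * j"] assms by (simp add: bern_fps_def bernoulli_num_def)
  then show ?thesis by (simp add: divide_less_0_iff)
qed

section \<open>The Stirling series\<close>

text \<open>The constant is a bound for the polynomial of degree \<open>M\<close> on the unit
  interval. It is chosen before \<open>f\<close>, \<open>K\<close> and \<open>x\<close>, so one
  constant serves all intervals at once.\<close>

lemma euler_maclaurin_step: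
  fixes M :: nat
  shows "\<exists>C\<ge>0. \<forall>f K x. (\<forall>k\<le>M. \<forall>t\<in>{x..x + 1}. (f k has_real_derivative f (Suc k) t) (at t)) \<longrightarrow>
    (\<forall>t\<in>{x..x + 1}. \<bar>f (Suc M) t\<bar> \<le> K) \<longrightarrow>
    \<bar>\<Sum>k\<le>M. (-1) ^ k / fact k * (bernpoly k 1 * f k (x + 1) - bernpoly k 0 * f k x)\<bar> \<le> C * (K :: real)"
proof -
  have "bounded (bernpoly M ` {0..1})"
    by (intro compact_imp_bounded compact_continuous_image continuous_on_bernpoly) auto
  then obtain C where C: "0 < C" "\<And>t. 0 \<le> t \<Longrightarrow> t \<le> 1 \<Longrightarrow> \<bar>bernpoly M t\<bar> \<le> C"
    by (auto simp: bounded_pos)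
  show ?thesis
  proof (intro exI[of _ C] conjI allI impI)
    fix f :: "nat \<Rightarrow> real \<Rightarrow> real" and K x :: real
    assume f: "\<forall>k\<le>M. \<forall>t\<in>{x..x + 1}. (f k has_real_derivative f (Suc k) t) (at t)"
    assume K: "\<forall>t\<in>{x..x + 1}. \<bar>f (Suc M) t\<bar> \<le> K"
    define h where "h m t = (\<Sum>k\<le>m. (-1) ^ k / fact k * (bernpoly k t * f k (x + t)))" for m t
    \<comment> \<open>Induction on \<open>m\<close>: by the derivative rule for Bernoulli
      polynomials, the new summand contributes the negative of the former end term together with the
      next end term.\<close>
    have h: "(h m has_real_derivative (-1) ^ m / fact m * (bernpoly m t * f (Suc m) (x + t))) (at t)"
      if "m \<le> M" "0 \<le> t" "t \<le> 1" for m t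
      using that(1)
    proof (induction m)
      case 0
      have "((\<lambda>t. f 0 (x + t)) has_real_derivative f (Suc 0) (x + t)) (at t)"
        using f[rule_format, of 0 "x + t"] that by (simp add: DERIV_shift add.commute)
      then show ?case by (simp add: h_def)
    next
      case (Suc m)
      have d: "((\<lambda>t. f (Suc m) (x + t)) has_real_derivative f (Suc (Suc m)) (x + t)) (at t)"
        using f[rule_format, of "Suc m" "x + t"] that Suc.prems by (simp add: DERIV_shift add.commute)
      have "((\<lambda>t. h m t + (-1) ^ Suc m / fact (Suc m) * (bernpoly (Suc m) t * f (Suc m) (x + t)))
        has_real_derivative (-1) ^ m / fact m * (bernpoly m t * f (Suc m) (x + t))
          + (-1) ^ Suc m / fact (Suc m) * (real (Suc m) * bernpoly m t * f (Suc m) (x + t)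
            + f (Suc (Suc m)) (x + t) * bernpoly (Suc m) t)) (at t)"
        using Suc by (intro DERIV_add DERIV_cmult DERIV_mult d has_real_derivative_bernpoly) auto
      moreover have "(-1) ^ m / fact m * (bernpoly m t * f (Suc m) (x + t))
          + (-1) ^ Suc m / fact (Suc m) * (real (Suc m) * bernpoly m t * f (Suc m) (x + t)
            + f (Suc (Suc m)) (x + t) * bernpoly (Suc m) t)
        = (-1) ^ Suc m / fact (Suc m) * (bernpoly (Suc m) t * f (Suc (Suc m)) (x + t))"
      proof -
        have "(-1) ^ Suc m / fact (Suc m) * real (Suc m) = (- ((-1) ^ m / fact m) :: real)"
          by (simp add: fact_Suc del: of_nat_Suc)
        then have "(-1) ^ Suc m / fact (Suc m) * (real (Suc m) * b * c + d) =
          - ((-1) ^ m / fact m * (b * c)) + (-1) ^ Suc m / fact (Suc m) * d" for b c d :: real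
          by (metis distrib_left mult.assoc mult_minus_left)
        then show ?thesis by (simp only: mult.commute[of "bernpoly (Suc m) t"])
      qed
      moreover have "h (Suc m) = (\<lambda>t. h m t + (-1) ^ Suc m / fact (Suc m) * (bernpoly (Suc m) t * f (Suc m) (x + t)))"
        by (auto simp: h_def)
      ultimately show ?case by simp
    qed
    have "\<exists>z>0. z < 1 \<and> h M 1 - h M 0 = (1 - 0) * ((-1) ^ M / fact M * (bernpoly M z * f (Suc M) (x + z)))"
      by (rule MVT2) (use h in auto)
    then obtain z where z: "0 < z" "z < 1"
      "h M 1 - h M 0 = (-1) ^ M / fact M * (bernpoly M z * f (Suc M) (x + z))" by auto
    have "\<bar>h M 1 - h M 0\<bar> = \<bar>bernpoly M z\<bar> * \<bar>f (Suc M) (x + z)\<bar> / fact M"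
      unfolding z(3) by (simp add: abs_mult power_abs)
    also have "\<dots> \<le> \<bar>bernpoly M z\<bar> * \<bar>f (Suc M) (x + z)\<bar> / 1"
      by (intro divide_left_mono) auto
    also have "\<dots> \<le> C * K"
      using C(2)[of z] K[rule_format, of "x + z"] z(1,2) by (simp add: mult_mono)
    finally show "\<bar>\<Sum>k\<le>M. (-1) ^ k / fact k * (bernpoly k 1 * f k (x + 1) - bernpoly k 0 * f k x)\<bar> \<le> C * K"
      by (simp add: h_def right_diff_distrib sum_subtractf)
  qed (use C in auto)
qed

text \<open>The sign \<open>(-1)\<^sup>k\<^sup>+\<^sup>1\<close> of \<open>log_coeff\<close> is absent, as these coefficients vanish for even \<open>k\<close>.\<close>

definition stirling_coeff :: "nat \<Rightarrow> real" where
  "stirling_coeff k = bernoulli_num (k + 1) / (real k * real (k + 1))"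

text \<open>The constant \<open>ln (2 * pi) / 2\<close> is left out, because the step estimate sees
  only differences in \<open>x\<close>. It is recovered afterwards as a limit.\<close>

definition stirling_sum :: "nat \<Rightarrow> real \<Rightarrow> real" where
  "stirling_sum M x = x * ln x - x + ln x / 2 + (\<Sum>i=1..M. stirling_coeff i / x ^ i)"

text \<open>The list of functions starts with an antiderivative of \<open>ln\<close>, so that the
  boundary term of index 0 is the integral of \<open>ln\<close> over the interval.\<close>

fun ln_derivs :: "nat \<Rightarrow> real \<Rightarrow> real" where
  "ln_derivs 0 x = x * ln x - x"
| "ln_derivs (Suc 0) x = ln x"
| "ln_derivs (Suc (Suc k)) x = (-1) ^ k * fact k / x ^ Suc k"

lemma ln_derivs_eta:
  "ln_derivs 0 = (\<lambda>x. x * ln x - x)" "ln_derivs (Suc 0) = ln"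
  "ln_derivs (Suc (Suc k)) = (\<lambda>x. (-1) ^ k * fact k / x ^ Suc k)"
  by (simp_all add: fun_eq_iff)

lemma has_real_derivative_ln_derivs:
  assumes "0 < x"
  shows "(ln_derivs k has_real_derivative ln_derivs (Suc k) x) (at x)"
proof -
  consider "k = 0" | "k = Suc 0" | j where "k = Suc (Suc j)" by (metis not0_implies_Suc)
  then show ?thesis
  proof cases
    case 1
    have "((\<lambda>x. x * ln x - x) has_real_derivative ln x) (at x)"
      using assms by (auto intro!: derivative_eq_intros)
    then show ?thesis unfolding 1 ln_derivs_eta .
  next
    case 2
    have "(ln has_real_derivative 1 / x) (at x)"
      using assms by (auto intro!: derivative_eq_intros simp: field_simps)
    then show ?thesis unfolding 2 ln_derivs_eta by simp
  next
    case (3 j)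
    have "((\<lambda>x. x ^ Suc j) has_real_derivative real (Suc j) * x ^ j) (at x)"
      using DERIV_pow[of "Suc j" x UNIV] by simp
    then have "((\<lambda>x. (-1) ^ j * fact j / x ^ Suc j) has_real_derivative
        (0 * x ^ Suc j - (-1) ^ j * fact j * (real (Suc j) * x ^ j)) / (x ^ Suc j * x ^ Suc j)) (at x)"
      using assms by (intro DERIV_divide DERIV_const) auto
    moreover have "(0 * x ^ Suc j - (-1) ^ j * fact j * (real (Suc j) * x ^ j)) / (x ^ Suc j * x ^ Suc j)
      = ln_derivs (Suc k) x"
      using assms by (simp add: 3 fact_Suc divide_simps)
    ultimately show ?thesis unfolding 3 ln_derivs_eta(3) by (simp only:)
  qed
qed

text \<open>Euler-Maclaurin of order \<open>Suc M\<close> for \<open>ln_derivs\<close>: the boundary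
  sum is exactly the quantity to be bounded, and the next derivative has absolute value
  \<open>fact M / t ^ Suc M\<close>, which is largest at the left end.\<close>

lemma stirling_sum_step:
  "\<exists>C. \<forall>x\<ge>1. \<bar>stirling_sum M (x + 1) - stirling_sum M x - ln (x + 1)\<bar> \<le> C / x ^ Suc M"
proof -
  obtain C where C: "0 \<le> C"
    "\<forall>f K x. (\<forall>k\<le>Suc M. \<forall>t\<in>{x..x + 1}. (f k has_real_derivative f (Suc k) t) (at t)) \<longrightarrow>
      (\<forall>t\<in>{x..x + 1}. \<bar>f (Suc (Suc M)) t\<bar> \<le> K) \<longrightarrow>
      \<bar>\<Sum>k\<le>Suc M. (-1) ^ k / fact k * (bernpoly k 1 * f k (x + 1) - bernpoly k 0 * f k x)\<bar> \<le> C * (K :: real)"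
    using euler_maclaurin_step[of "Suc M"] by blast
  have "\<bar>stirling_sum M (x + 1) - stirling_sum M x - ln (x + 1)\<bar> \<le> (C * fact M) / x ^ Suc M" if x: "1 \<le> x" for x
  proof -
    define h where "h k = (-1) ^ k / fact k * (bernpoly k 1 * ln_derivs k (x + 1) - bernpoly k 0 * ln_derivs k x)" for k
    have "\<bar>\<Sum>k\<le>Suc M. h k\<bar> \<le> C * (fact M / x ^ Suc M)"
      unfolding h_def
    proof (rule C(2)[rule_format])
      fix t assume "t \<in> {x..x + 1}"
      then have "x \<le> t" by simp
      then have "x ^ Suc M \<le> t ^ Suc M" using x by (intro power_mono) auto
      then have "fact M / t ^ Suc M \<le> fact M / x ^ Suc M"
        using x \<open>x \<le> t\<close> by (intro divide_left_mono mult_pos_pos) auto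
      then show "\<bar>ln_derivs (Suc (Suc M)) t\<bar> \<le> fact M / x ^ Suc M"
        using x \<open>x \<le> t\<close> by (simp add: abs_mult power_abs)
    qed (use x in \<open>auto intro!: has_real_derivative_ln_derivs\<close>)
    moreover have "(\<Sum>k\<le>Suc M. h k) = stirling_sum M (x + 1) - stirling_sum M x - ln (x + 1)"
    proof -
      have "{..M} = insert 0 {1..M}" by auto
      then have "(\<Sum>k\<le>Suc M. h k) = h 0 + (h 1 + (\<Sum>i=1..M. h (Suc i)))"
        by (simp add: sum.atMost_Suc_shift del: sum.atMost_Suc)
      moreover have "h (Suc i) = stirling_coeff i / (x + 1) ^ i - stirling_coeff i / x ^ i"
        if "i \<in> {1..M}" for i
      proof -
        obtain j where j: "i = Suc j" using \<open>i \<in> {1..M}\<close> by (cases i) auto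
        have eqs: "bernpoly (Suc i) 1 = bernoulli_num (Suc i)" "bernpoly (Suc i) 0 = bernoulli_num (Suc i)"
          using j by (auto simp: bernpoly_1_eq bernoulli_num_def)
        have "h (Suc i) = ((-1) ^ Suc i / fact (Suc i) * ((-1) ^ j * fact j)) *
            (bernoulli_num (Suc i) / (x + 1) ^ i - bernoulli_num (Suc i) / x ^ i)"
        proof -
          have "c * (b * (e / u) - b * (e / v)) = (c * e) * (b / u - b / v)" for b c e u v :: real
            by (simp add: algebra_simps)
          then show ?thesis
            by (simp only: h_def eqs[unfolded j] ln_derivs.simps j)
        qed
        \<comment> \<open>With \<open>i = Suc j\<close> the two signs have the same parity and
          cancel, and the factorials leave \<open>1 / (i * (i + 1))\<close>, the denominator of
          \<open>stirling_coeff\<close>.\<close>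
        also have "(-1) ^ Suc i / fact (Suc i) * ((-1) ^ j * fact j) =
            ((-1) ^ j * (-1) ^ j) * (1 / (real i * real (Suc i)))"
          by (simp add: j fact_Suc divide_simps)
        also have "(-1) ^ j * (-1) ^ j = (1 :: real)"
          by (simp flip: power_mult_distrib)
        finally show ?thesis by (simp add: stirling_coeff_def right_diff_distrib)
      qed
      moreover have "h 0 = ((x + 1) * ln (x + 1) - (x + 1)) - (x * ln x - x)" by (simp add: h_def)
      moreover have "h 1 = - (ln (x + 1) / 2 + ln x / 2)"
        using bernoulli_num_1 by (simp add: h_def bernpoly_1_eq bernoulli_num_def)
      ultimately show ?thesis
        by (simp add: stirling_sum_def sum_subtractf)
    qed
    ultimately show ?thesis by simp
  qed
  then show ?thesis by blast
qed

text \<open>The steps are dominated by the telescoping differences of \<open>1 / n ^ r\<close>. This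
  gives the Cauchy property and, in the limit, a tail bound that loses exactly one power of
  \<open>n\<close>.\<close>

lemma convergent_of_summable_steps:
  fixes d :: "nat \<Rightarrow> real"
  assumes "1 \<le> r" and step: "\<And>n. 1 \<le> n \<Longrightarrow> \<bar>d (Suc n) - d n\<bar> \<le> K / real n ^ Suc r"
  shows "\<exists>L. d \<longlonglongrightarrow> L \<and> (\<forall>n\<ge>1. \<bar>d n - L\<bar> \<le> 2 * K / real n ^ r)"
proof -
  have K: "0 \<le> K" using step[of 1] by simp
  \<comment> \<open>With \<open>q = n / (n + 1)\<close>, the bound \<open>q ^ r \<le> q\<close>
    reduces the claim to \<open>1 / n \<le> 2 / (n + 1)\<close>, which explains the factor
    2.\<close>
  have gap: "1 / real n ^ Suc r \<le> 2 * (1 / real n ^ r - 1 / real (Suc n) ^ r)" if n: "1 \<le> n" for n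
  proof -
    define a q where "a = 1 / real n ^ r" and "q = real n / real (Suc n)"
    have "q ^ r \<le> q ^ 1"
      using assms(1) by (intro power_decreasing) (auto simp: q_def)
    then have "a * q ^ r \<le> a * q"
      by (intro mult_left_mono) (auto simp: a_def)
    moreover have "a * q ^ r = 1 / real (Suc n) ^ r"
      using n by (simp add: a_def q_def power_divide)
    moreover have "1 / real n ^ Suc r = a * (1 / real n)" by (simp add: a_def)
    moreover have "a * (1 / real n) \<le> a * (2 * (1 - q))"
      using n by (intro mult_left_mono) (auto simp: a_def q_def divide_simps)
    ultimately show ?thesis by (simp add: a_def[symmetric] algebra_simps)
  qed
  have bound: "\<bar>d m - d n\<bar> \<le> 2 * K * (1 / real n ^ r - 1 / real m ^ r)" if "1 \<le> n" "n \<le> m" for m n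
    using that(2)
  proof (induction m rule: dec_induct)
    case (step m)
    have "\<bar>d (Suc m) - d m\<bar> \<le> K * (1 / real m ^ Suc r)"
      using assms(2)[of m] step.hyps that(1) by simp
    also have "\<dots> \<le> K * (2 * (1 / real m ^ r - 1 / real (Suc m) ^ r))"
      using K gap[of m] step.hyps that(1) by (intro mult_left_mono) auto
    finally show ?case using step.IH by (simp add: algebra_simps)
  qed simp
  then have bound': "\<bar>d m - d n\<bar> \<le> 2 * K / real n ^ r" if "1 \<le> n" "n \<le> m" for m n
  proof -
    have "2 * K * (1 / real n ^ r - 1 / real m ^ r) \<le> 2 * K * (1 / real n ^ r)"
      using K by (intro mult_left_mono) auto
    then show ?thesis using bound[OF that] by simp
  qed
  have null: "(\<lambda>n. 2 * K / real n ^ r) \<longlonglongrightarrow> 0"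
  proof -
    have "filterlim (\<lambda>n. real n ^ r) at_top sequentially"
      using assms(1) by (intro filterlim_pow_at_top filterlim_real_sequentially) auto
    then show ?thesis by (intro real_tendsto_divide_at_top[OF tendsto_const])
  qed
  have "Cauchy d"
  proof (rule metric_CauchyI)
    fix e :: real assume "0 < e"
    then have "\<forall>\<^sub>F n in sequentially. 2 * K / real n ^ r < e / 2 \<and> 1 \<le> n"
      using order_tendstoD(2)[OF null, of "e / 2"] by (intro eventually_conj eventually_ge_at_top) auto
    then obtain N where N: "2 * K / real N ^ r < e / 2" "1 \<le> N"
      unfolding eventually_sequentially by blast
    have "dist (d m) (d n) < e" if "N \<le> m" "N \<le> n" for m n
      using bound'[of N m] bound'[of N n] N that by (simp add: dist_real_def)
    then show "\<exists>N. \<forall>m\<ge>N. \<forall>n\<ge>N. dist (d m) (d n) < e" by blast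
  qed
  then obtain L where L: "d \<longlonglongrightarrow> L" by (meson Cauchy_convergent convergent_def)
  moreover have "\<bar>d n - L\<bar> \<le> 2 * K / real n ^ r" if "1 \<le> n" for n
  proof -
    have "(\<lambda>m. \<bar>d m - d n\<bar>) \<longlonglongrightarrow> \<bar>L - d n\<bar>" by (intro tendsto_intros L)
    then have "\<bar>L - d n\<bar> \<le> 2 * K / real n ^ r"
      by (rule tendsto_upperbound) (use bound' that in \<open>auto simp: eventually_sequentially\<close>)
    then show ?thesis by (simp add: abs_minus_commute)
  qed
  ultimately show ?thesis by blast
qed

section \<open>The constant in Stirling's formula, from the Wallis product\<close>

lemma wallis_prod_eq:
  "(\<Prod>k=1..n. (4 * real k ^ 2) / (4 * real k ^ 2 - 1)) =
     2 ^ (4 * n) * fact n ^ 4 / (fact (2 * n) ^ 2 * (2 * real n + 1))"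
proof (induction n)
  case (Suc n)
  have nz: "4 * real (Suc n) ^ 2 - 1 = (2 * real n + 1) * (2 * real n + 3)"
    by (simp add: power2_eq_square algebra_simps)
  have f: "fact (2 * Suc n) = (2 * real (Suc n) * (2 * real n + 1)) * fact (2 * n)"
    by (simp add: algebra_simps)
  define F where "F = (fact (2 * n) :: real)"
  define G where "G = (fact n :: real)"
  have pos: "F \<noteq> 0" "2 * real n + 1 \<noteq> 0" "2 * real n + 3 \<noteq> 0" "real (Suc n) \<noteq> 0"
    by (simp_all add: F_def add_eq_0_iff)
  have "(\<Prod>k=1..Suc n. (4 * real k ^ 2) / (4 * real k ^ 2 - 1)) =
     2 ^ (4 * n) * G ^ 4 / (F ^ 2 * (2 * real n + 1)) * (4 * real (Suc n) ^ 2 / ((2 * real n + 1) * (2 * real n + 3)))"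
    using Suc by (simp add: nz[simplified] F_def G_def)
  also have "\<dots> = 2 ^ (4 * n) * 16 * (real (Suc n) * G) ^ 4 /
      (((2 * real (Suc n) * (2 * real n + 1)) * F) ^ 2 * (2 * real n + 3))"
    using pos by (simp add: divide_simps del: of_nat_Suc) (simp add: power2_eq_square power4_eq_xxxx)
  also have "\<dots> = 2 ^ (4 * Suc n) * fact (Suc n) ^ 4 / (fact (2 * Suc n) ^ 2 * (2 * real (Suc n) + 1))"
    unfolding f by (simp add: F_def G_def algebra_simps power_add)
  finally show ?case .
qed simp

text \<open>In \<open>4 * g n - 2 * g (2 * n)\<close> the terms of size \<open>n * ln n\<close> and
  \<open>n\<close> cancel, up to the \<open>4 * n * ln 2\<close> that belongs to the logarithm of
  the Wallis product. Its limit \<open>ln (pi / 2)\<close> then determines \<open>L\<close>.\<close>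

lemma stirling_constant:
  assumes "(\<lambda>n. ln (fact n) - stirling_sum 0 (real n)) \<longlonglongrightarrow> L"
  shows "L = ln (2 * pi) / 2"
proof -
  define g where "g n = ln (fact n) - stirling_sum 0 (real n)" for n
  have g: "g \<longlonglongrightarrow> L" using assms by (simp add: g_def[abs_def])
  have g2: "(\<lambda>n. g (2 * n)) \<longlonglongrightarrow> L"
    by (rule filterlim_compose[OF g]) (auto intro: filterlim_subseq simp: strict_mono_def)
  \<comment> \<open>These are the logarithmic terms by which the combination of \<open>g\<close>
    differs from the logarithm of the Wallis product.\<close>
  have "(\<lambda>n::nat. 2 * ln (real n) - ln (2 * real n) - ln (2 * real n + 1)) \<longlonglongrightarrow> - 2 * ln 2"
    by real_asymp
  then have "(\<lambda>n. 4 * g n - 2 * g (2 * n) + (2 * ln (real n) - ln (2 * real n) - ln (2 * real n + 1)))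
      \<longlonglongrightarrow> 4 * L - 2 * L + (- 2 * ln 2)"
    by (intro tendsto_intros g g2)
  moreover have "\<forall>\<^sub>F n in sequentially.
      4 * g n - 2 * g (2 * n) + (2 * ln (real n) - ln (2 * real n) - ln (2 * real n + 1)) =
      ln (\<Prod>k=1..n. (4 * real k ^ 2) / (4 * real k ^ 2 - 1))"
    using eventually_gt_at_top[of 0]
  proof eventually_elim
    case (elim n)
    have "ln (\<Prod>k=1..n. (4 * real k ^ 2) / (4 * real k ^ 2 - 1)) =
        4 * real n * ln 2 + 4 * ln (fact n) - (2 * ln (fact (2 * n)) + ln (2 * real n + 1))"
      unfolding wallis_prod_eq
      by (subst ln_div, simp_all) (simp add: ln_mult ln_realpow add_pos_pos)
    then show ?case using elim
      by (simp add: g_def stirling_sum_def ln_mult add_divide_distrib diff_divide_distrib algebra_simps)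
  qed
  moreover have "(\<lambda>n. ln (\<Prod>k=1..n. (4 * real k ^ 2) / (4 * real k ^ 2 - 1))) \<longlonglongrightarrow> ln (pi / 2)"
    by (intro tendsto_ln wallis) auto
  ultimately have "4 * L - 2 * L + (- 2 * ln 2) = ln (pi / 2)"
    by (intro LIMSEQ_unique[OF Lim_transform_eventually])
  then show ?thesis by (simp add: ln_div ln_mult)
qed

definition stirling_remainder :: "nat \<Rightarrow> real" where
  "stirling_remainder n = ln (fact n) - (real n * ln (real n) - real n + ln (real n) / 2 + ln (2 * pi) / 2)"

theorem stirling_series:
  obtains K where "\<And>n. 1 \<le> n \<Longrightarrow>
    \<bar>stirling_remainder n - (\<Sum>i=1..M. stirling_coeff i / real n ^ i)\<bar> \<le> K / real n ^ Suc M"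
proof -
  \<comment> \<open>One term more than requested is used: the steps are then of order
    \<open>M + 2\<close> and the tail of order \<open>M + 1\<close>. The surplus term has the same
    order and is absorbed into the constant.\<close>
  define d where "d n = ln (fact n) - stirling_sum (Suc M) (real n)" for n
  obtain C where C: "\<forall>x\<ge>1. \<bar>stirling_sum (Suc M) (x + 1) - stirling_sum (Suc M) x - ln (x + 1)\<bar> \<le> C / x ^ Suc (Suc M)"
    using stirling_sum_step[of "Suc M"] by blast
  have "\<bar>d (Suc n) - d n\<bar> \<le> C / real n ^ Suc (Suc M)" if "1 \<le> n" for n
  proof -
    have "ln (fact (Suc n)) = ln (real n + 1) + ln (fact n)"
      by (simp add: ln_mult add.commute)
    then have "d (Suc n) - d n = - (stirling_sum (Suc M) (real n + 1) - stirling_sum (Suc M) (real n) - ln (real n + 1))"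
      by (simp add: d_def add.commute)
    then show ?thesis using C[rule_format, of "real n"] that by (simp only: abs_minus_cancel)
  qed
  then have "\<exists>L. d \<longlonglongrightarrow> L \<and> (\<forall>n\<ge>1. \<bar>d n - L\<bar> \<le> 2 * C / real n ^ Suc M)"
    by (intro convergent_of_summable_steps) auto
  then obtain L where L: "d \<longlonglongrightarrow> L" "\<forall>n\<ge>1. \<bar>d n - L\<bar> \<le> 2 * C / real n ^ Suc M"
    by blast
  have split: "stirling_sum N x = stirling_sum 0 x + (\<Sum>i=1..N. stirling_coeff i / x ^ i)" for N x
    by (simp add: stirling_sum_def)
  have "(\<lambda>n. \<Sum>i=1..Suc M. stirling_coeff i / real n ^ i) \<longlonglongrightarrow> (\<Sum>i=1..Suc M. 0)"
    by (intro tendsto_sum real_tendsto_divide_at_top[OF tendsto_const]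
        filterlim_pow_at_top filterlim_real_sequentially) auto
  from tendsto_add[OF L(1) this] have "(\<lambda>n. ln (fact n) - stirling_sum 0 (real n)) \<longlonglongrightarrow> L"
    unfolding d_def split[of "Suc M"] by simp
  then have Leq: "L = ln (2 * pi) / 2" by (rule stirling_constant)
  show ?thesis
  proof (rule that)
    fix n :: nat assume n: "1 \<le> n"
    have "stirling_remainder n - (\<Sum>i=1..M. stirling_coeff i / real n ^ i)
        = (d n - L) + stirling_coeff (Suc M) / real n ^ Suc M"
      by (simp add: stirling_remainder_def d_def Leq stirling_sum_def)
    also have "\<bar>\<dots>\<bar> \<le> \<bar>d n - L\<bar> + \<bar>stirling_coeff (Suc M) / real n ^ Suc M\<bar>"
      by (rule abs_triangle_ineq)
    also have "\<dots> \<le> \<bar>2 * C\<bar> / real n ^ Suc M + \<bar>stirling_coeff (Suc M)\<bar> / real n ^ Suc M"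
    proof (rule add_mono)
      show "\<bar>d n - L\<bar> \<le> \<bar>2 * C\<bar> / real n ^ Suc M"
        by (rule order_trans[OF L(2)[rule_format, OF n]]) (intro divide_right_mono, auto)
    qed (simp add: abs_divide)
    finally show "\<bar>stirling_remainder n - (\<Sum>i=1..M. stirling_coeff i / real n ^ i)\<bar>
        \<le> (\<bar>2 * C\<bar> + \<bar>stirling_coeff (Suc M)\<bar>) / real n ^ Suc M"
      by (simp add: add_divide_distrib)
  qed
qed

section \<open>The mean absolute deviation\<close>

text \<open>This is De Moivre's formula at a lattice point. The two halves of the sum, below and
  above the mean, each telescope to \<open>u m\<close>.\<close>

lemma binomial_mad_lattice:
  assumes p: "0 < p" "p < 1" and m: "real m = real N * p"
  shows "binomial_mad N p = 2 * real m * (1 - p) * (real (N choose m) * p ^ m * (1 - p) ^ (N - m))"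
proof -
  define b where "b k = real (N choose k) * p ^ k * (1 - p) ^ (N - k)" for k
  define u where "u k = real k * (1 - p) * b k" for k
  \<comment> \<open>This rests on
    \<open>(k + 1) * (N choose (k + 1)) = (N - k) * (N choose k)\<close>. At \<open>k = N\<close> it
    persists because \<open>N choose Suc N\<close> is 0, which also makes \<open>u (Suc N)\<close>
    vanish.\<close>
  have tele: "b k * (real N * p - real k) = u (Suc k) - u k" if k: "k \<le> N" for k
  proof (cases "k = N")
    case False
    then obtain d where d: "N = Suc (k + d)" using less_imp_Suc_add[of k N] k by auto
    have "Suc k * (N choose Suc k) = (N - k) * (N choose k)"
      by (simp only: binomial_absorption binomial_absorb_comp)
    then have "real (Suc k) * real (N choose Suc k) = real (N choose k) * real (N - k)"
      by (metis mult.commute of_nat_mult)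
    then have "u (Suc k) = (real (N choose k) * real (N - k)) * (p ^ Suc k * (1 - p) ^ (N - k))"
      unfolding u_def b_def by (simp only: mult.assoc[symmetric]) (simp add: d mult_ac)
    then show ?thesis by (simp add: u_def b_def d algebra_simps)
  qed (simp add: u_def b_def binomial_eq_0 algebra_simps)
  have "real m \<le> real N" unfolding m using p mult_left_le[of p "real N"] by simp
  then have mN: "m \<le> N" by simp
  have "binomial_mad N p = (\<Sum>k\<le>N. b k * \<bar>real k - real N * p\<bar>)"
    unfolding binomial_mad_def b_def using p by (subst expectation_binomial_pmf') auto
  \<comment> \<open>The sign of \<open>real N * p - real k\<close> changes at \<open>m\<close>, so
    the absolute value resolves to one sign on each piece.\<close>
  also have "{..N} = {..<m} \<union> {m..<Suc N}" using mN by auto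
  also have "(\<Sum>k\<in>\<dots>. b k * \<bar>real k - real N * p\<bar>) =
      (\<Sum>k<m. b k * \<bar>real k - real N * p\<bar>) + (\<Sum>k=m..<Suc N. b k * \<bar>real k - real N * p\<bar>)"
    by (intro sum.union_disjoint) auto
  also have "(\<Sum>k<m. b k * \<bar>real k - real N * p\<bar>) = (\<Sum>k<m. u (Suc k) - u k)"
    using mN by (intro sum.cong refl) (simp flip: m tele)
  also have "\<dots> = u m - u 0" by (rule sum_lessThan_telescope)
  also have "(\<Sum>k=m..<Suc N. b k * \<bar>real k - real N * p\<bar>) = (\<Sum>k=m..<Suc N. - (u (Suc k) - u k))"
  proof (intro sum.cong refl)
    fix k assume "k \<in> {m..<Suc N}"
    then have "\<bar>real k - real N * p\<bar> = - (real N * p - real k)" and "k \<le> N" by (simp_all flip: m)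
    then show "b k * \<bar>real k - real N * p\<bar> = - (u (Suc k) - u k)"
      by (simp only: mult_minus_right tele)
  qed
  also have "\<dots> = - (u (Suc N) - u m)"
    using mN by (simp only: sum_negf sum_Suc_diff')
  finally have "binomial_mad N p = (u m - u 0) + - (u (Suc N) - u m)" .
  then show ?thesis by (simp add: u_def b_def)
qed

lemma log_mad_ratio_lattice:
  assumes p: "0 < p" "p < 1" and N: "0 < N" and m: "real m = real N * p"
  shows "log_mad_ratio N p = stirling_remainder N - stirling_remainder m - stirling_remainder (N - m)"
proof -
  \<comment> \<open>Both \<open>m\<close> and \<open>N - m\<close> must be positive, so that all the
    logarithms below have positive arguments and split over products.\<close>
  have m0: "0 < m" using p N m by (metis mult_pos_pos of_nat_0_less_iff)
  have "real m < real N" unfolding m using p N by simp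
  then have mN: "m < N" by simp
  define l where "l = N - m"
  have l: "real l = real N * (1 - p)" using mN m by (simp add: l_def of_nat_diff algebra_simps)
  have lm: "real l = real N - real m" using mN by (simp add: l_def of_nat_diff)
  have l0: "0 < l" using mN by (simp add: l_def)
  have lnm: "ln (real m) = ln (real N) + ln p" and lnl: "ln (real l) = ln (real N) + ln (1 - p)"
    unfolding m l using p N by (simp_all add: ln_mult)
  have "real (N choose m) = fact N / (fact m * fact l)"
    using binomial_fact[of m N] mN by (simp add: l_def)
  then have "log_mad_ratio N p = ln (2 * real m * (1 - p) * (fact N / (fact m * fact l) * p ^ m * (1 - p) ^ l)
      / sqrt (2 * real N * p * (1 - p) / pi))"
    using binomial_mad_lattice[OF p m] by (simp add: log_mad_ratio_def l_def)
  also have "\<dots> = ln 2 + ln (real m) + ln (1 - p) + (ln (fact N) - (ln (fact m) + ln (fact l)))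
      + real m * ln p + real l * ln (1 - p) - (ln 2 + ln (real N) + ln p + ln (1 - p) - ln pi) / 2"
    using p N m0 l0 by (simp add: ln_mult ln_div ln_sqrt ln_realpow)
  finally have L: "log_mad_ratio N p = \<dots>" .
  show ?thesis
    unfolding L stirling_remainder_def l_def[symmetric] lnm lnl
    unfolding lm by (simp add: ln_mult add_divide_distrib diff_divide_distrib algebra_simps)
qed

section \<open>The coefficients at zero offset\<close>

lemma log_coeff_0:
  assumes "1 \<le> k"
  shows "log_coeff k 0 p = stirling_coeff k * (1 - 1 / p ^ k - 1 / (1 - p) ^ k)"
\<comment> \<open>For even \<open>k\<close> both sides vanish, since \<open>k + 1\<close> is odd and
  at least 3. For odd \<open>k\<close> all the signs equal 1. The common form matches the three
  Stirling series term by term.\<close>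
proof (cases "even k")
  case True
  then have "bernoulli_num (k + 1) = 0" using assms by (intro bernoulli_num_odd) auto
  then show ?thesis by (simp add: log_coeff_def stirling_coeff_def flip: bernoulli_num_def)
next
  case False
  then show ?thesis
    by (simp add: log_coeff_def stirling_coeff_def power_int_minus divide_inverse algebra_simps
        flip: bernoulli_num_def)
qed

lemma log_coeff_even:
  assumes "1 \<le> m" shows "log_coeff (2 * m) 0 p = 0"
  using assms bernoulli_num_odd[of "2 * m + 1"] by (simp add: log_coeff_0 stirling_coeff_def)

lemma log_coeff_odd:
  assumes "1 \<le> j"
  shows "log_coeff (2 * j - 1) 0 p = bernoulli_num (2 * j) / (real (2 * j - 1) * real (2 * j)) *
    (1 - (p powi (1 - 2 * int j) + (1 - p) powi (1 - 2 * int j)))"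
proof -
  have "1 - 2 * int j = - int (2 * j - 1)" using assms by (simp add: of_nat_diff)
  then have "x powi (1 - 2 * int j) = 1 / x ^ (2 * j - 1)" for x :: real
    by (simp only: power_int_minus power_int_of_nat inverse_eq_divide)
  then show ?thesis
    using assms by (simp add: log_coeff_0 stirling_coeff_def)
qed

text \<open>Two negative factors: the Bernoulli number multiplied by \<open>(-1) ^ j\<close>, and
  the bracket, in which \<open>1 / p ^ (2 * j - 1)\<close> alone already outweighs the 1.\<close>

lemma log_coeff_odd_sign:
  assumes "0 < p" "p < 1" "1 \<le> j"
  shows "(-1) ^ j * log_coeff (2 * j - 1) 0 p > 0"
proof -
  have "1 \<le> 1 / p ^ (2 * j - 1)" using assms by (simp add: power_le_one)
  moreover have "0 < 1 / (1 - p) ^ (2 * j - 1)" using assms by simp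
  ultimately have "1 - 1 / p ^ (2 * j - 1) - 1 / (1 - p) ^ (2 * j - 1) < 0" by linarith
  moreover have "(-1) ^ j * stirling_coeff (2 * j - 1) < 0"
  proof -
    have "(-1) ^ j * bernoulli_num (2 * j) / (real (2 * j - 1) * real (2 * j)) < 0"
      using assms(3) bernoulli_num_even_sign[of j] by (intro divide_neg_pos mult_pos_pos) auto
    then show ?thesis using assms(3) by (simp add: stirling_coeff_def)
  qed
  ultimately have "0 < ((-1) ^ j * stirling_coeff (2 * j - 1)) *
      (1 - 1 / p ^ (2 * j - 1) - 1 / (1 - p) ^ (2 * j - 1))"
    by (intro mult_neg_neg)
  then show ?thesis using assms(3) by (simp add: log_coeff_0 mult.assoc)
qed

section \<open>The asymptotic expansion along the lattice\<close>

lemma lattice_offset_eq_0: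
  assumes "real N * p \<in> \<int>" shows "lattice_offset N p = 0"
  using assms by (auto simp: lattice_offset_def elim!: Ints_cases)

text \<open>The Stirling series is inserted at \<open>N\<close>, \<open>N * p\<close> and
  \<open>N * (1 - p)\<close>. The last two arguments are fixed multiples of \<open>N\<close>, so
  their errors have the required order, with a constant depending on \<open>p\<close> and
  \<open>M\<close>.\<close>

lemma asymp_expansion_log_mad_ratio:
  assumes p: "0 < p" "p < 1"
  shows "asymp_expansion (lattice_sequentially p) (\<lambda>N. log_mad_ratio N p)
    (\<lambda>N k. log_coeff k 0 p) (\<lambda>k. k)"
  unfolding asymp_expansion_def
proof
  fix M
  obtain K where K: "\<And>n. 1 \<le> n \<Longrightarrow>
    \<bar>stirling_remainder n - (\<Sum>i=1..M. stirling_coeff i / real n ^ i)\<bar> \<le> K / real n ^ Suc M"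
    using stirling_series[of M] by blast
  define S where "S x = (\<Sum>i=1..M. stirling_coeff i / x ^ i)" for x
  have "norm (log_mad_ratio N p - (\<Sum>i | 1 \<le> i \<and> i \<le> M. log_coeff i 0 p / real N ^ i))
      \<le> K * (1 + 1 / p ^ Suc M + 1 / (1 - p) ^ Suc M) * norm (1 / real N ^ (M + 1))"
    if N: "1 \<le> N" and lat: "real N * p \<in> \<int>" for N
  proof -
    have "0 < real N * p" using p N by simp
    then obtain m where m: "real N * p = real m" 
      using lat by (metis Ints_cases nonneg_int_cases of_int_of_nat_eq of_int_0_less_iff less_imp_le)
    have "1 \<le> m" using \<open>0 < real N * p\<close> m by simp
    have "real m < real N" unfolding m[symmetric] using p N by simp
    then have "m < N" by simp
    define l where "l = N - m"
    have l: "real l = real N * (1 - p)" using \<open>m < N\<close> m by (simp add: l_def of_nat_diff algebra_simps)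
    have "1 \<le> l" using \<open>m < N\<close> by (simp add: l_def)
    have "(\<Sum>i | 1 \<le> i \<and> i \<le> M. log_coeff i 0 p / real N ^ i) =
        (\<Sum>i=1..M. stirling_coeff i / real N ^ i - stirling_coeff i / real m ^ i - stirling_coeff i / real l ^ i)"
    proof (rule sum.cong)
      fix i assume "i \<in> {1..M}"
      show "log_coeff i 0 p / real N ^ i =
          stirling_coeff i / real N ^ i - stirling_coeff i / real m ^ i - stirling_coeff i / real l ^ i"
      proof -
        have "c * (1 - 1 / a - 1 / b) / n = c / n - c / (n * a) - c / (n * b)" for a b c n :: real
          by (simp add: right_diff_distrib diff_divide_distrib mult.commute)
        moreover have "1 \<le> i" using \<open>i \<in> {1..M}\<close> by simp
        ultimately show ?thesis
          by (simp only: log_coeff_0 l m[symmetric] power_mult_distrib)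
      qed
    qed auto
    also have "\<dots> = S (real N) - S (real m) - S (real l)"
      by (simp add: S_def sum_subtractf)
    finally have "log_mad_ratio N p - (\<Sum>i | 1 \<le> i \<and> i \<le> M. log_coeff i 0 p / real N ^ i) =
        (stirling_remainder N - S (real N)) - (stirling_remainder m - S (real m)) - (stirling_remainder l - S (real l))"
      using log_mad_ratio_lattice[OF p _ m[symmetric]] N by (simp add: l_def)
    also have "\<bar>\<dots>\<bar> \<le> K / real N ^ Suc M + K / real m ^ Suc M + K / real l ^ Suc M"
      using K[OF N] K[OF \<open>1 \<le> m\<close>] K[OF \<open>1 \<le> l\<close>] unfolding S_def by linarith
    also have "\<dots> = K * (1 + 1 / p ^ Suc M + 1 / (1 - p) ^ Suc M) * (1 / real N ^ Suc M)"
    proof -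
      have "K / (a * b) = K * (1 / b) * (1 / a)" for a b :: real by simp
      then show ?thesis
        unfolding l m[symmetric] power_mult_distrib by (simp only: distrib_left distrib_right) simp
    qed
    finally show ?thesis by simp
  qed
  then have "\<forall>\<^sub>F N in lattice_sequentially p.
      norm (log_mad_ratio N p - (\<Sum>i | 1 \<le> i \<and> i \<le> M. log_coeff i 0 p / real N ^ i))
      \<le> K * (1 + 1 / p ^ Suc M + 1 / (1 - p) ^ Suc M) * norm (1 / real N ^ (M + 1))"
    unfolding lattice_sequentially_def eventually_inf_principal
    by (intro eventually_mono[OF eventually_ge_at_top[of 1]]) auto
  then show "(\<lambda>N. log_mad_ratio N p - (\<Sum>i | 1 \<le> i \<and> i \<le> M. log_coeff i 0 p / real N ^ i))
      \<in> O[lattice_sequentially p](\<lambda>N. 1 / real N ^ (M + 1))"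
    by (rule bigoI)
qed

text \<open>Only the truncated sums enter the definition, so coefficients and exponents may change
  together. This serves both to set the offset to 0 and to discard the even orders by
  reindexing.\<close>

lemma asymp_expansion_cong:
  assumes "\<And>M. \<forall>\<^sub>F N in F. (\<Sum>i | 1 \<le> i \<and> e i \<le> M. c N i / real N ^ e i) =
    (\<Sum>i | 1 \<le> i \<and> e' i \<le> M. c' N i / real N ^ e' i)"
  shows "asymp_expansion F f c e \<longleftrightarrow> asymp_expansion F f c' e'"
  unfolding asymp_expansion_def
  by (intro iff_allI landau_o.big.in_cong eventually_mono[OF assms]) simp

theorem theorem5p3:
  fixes p q :: real
  assumes "0 < p" and "p < 1" and "q = 1 - p"
  shows "(\<forall>N. real N * p \<in> \<int> \<longrightarrow> lattice_offset N p = 0)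
    \<and> asymp_expansion (lattice_sequentially p) (\<lambda>N. log_mad_ratio N p)
          (\<lambda>N k. log_coeff k (lattice_offset N p) p) (\<lambda>k. k)
    \<and> (\<forall>m\<ge>1. log_coeff (2 * m) 0 p = 0)
    \<and> asymp_expansion (lattice_sequentially p) (\<lambda>N. log_mad_ratio N p)
          (\<lambda>N j. log_coeff (2 * j - 1) 0 p) (\<lambda>j. 2 * j - 1)
    \<and> (\<forall>j\<ge>1. log_coeff (2 * j - 1) 0 p =
          bernoulli_num (2 * j) / (real (2 * j - 1) * real (2 * j)) *
            (1 - (p powi (1 - 2 * int j) + q powi (1 - 2 * int j))))
    \<and> (\<forall>j\<ge>1. (-1) ^ j * log_coeff (2 * j - 1) 0 p > 0)"
proof (intro conjI allI impI)
  have "\<forall>\<^sub>F N in lattice_sequentially p. lattice_offset N p = 0"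
    unfolding lattice_sequentially_def eventually_inf_principal
    by (simp add: lattice_offset_eq_0)
  then have "asymp_expansion (lattice_sequentially p) (\<lambda>N. log_mad_ratio N p)
      (\<lambda>N k. log_coeff k (lattice_offset N p) p) (\<lambda>k. k) \<longleftrightarrow>
    asymp_expansion (lattice_sequentially p) (\<lambda>N. log_mad_ratio N p) (\<lambda>N k. log_coeff k 0 p) (\<lambda>k. k)"
    by (intro asymp_expansion_cong) (auto elim: eventually_mono)
  then show "asymp_expansion (lattice_sequentially p) (\<lambda>N. log_mad_ratio N p)
      (\<lambda>N k. log_coeff k (lattice_offset N p) p) (\<lambda>k. k)"
    using asymp_expansion_log_mad_ratio[OF assms(1,2)] by simp
next
  \<comment> \<open>The injective map from \<open>j\<close> to \<open>2 * j - 1\<close> reaches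
    exactly the odd orders up to \<open>M\<close>; the remaining orders are even and have zero
    coefficients.\<close>
  have odd_part: "(\<Sum>i | 1 \<le> i \<and> i \<le> M. log_coeff i 0 p / real N ^ i) =
      (\<Sum>j | 1 \<le> j \<and> 2 * j - 1 \<le> M. log_coeff (2 * j - 1) 0 p / real N ^ (2 * j - 1))" for M N
  proof -
    define J where "J = {j. 1 \<le> j \<and> 2 * j - 1 \<le> M}"
    have "inj_on (\<lambda>j. 2 * j - 1) J" by (auto simp: inj_on_def J_def)
    then have "(\<Sum>j\<in>J. log_coeff (2 * j - 1) 0 p / real N ^ (2 * j - 1)) =
        (\<Sum>i\<in>(\<lambda>j. 2 * j - 1) ` J. log_coeff i 0 p / real N ^ i)"
      by (simp add: sum.reindex)
    also have "\<dots> = (\<Sum>i | 1 \<le> i \<and> i \<le> M. log_coeff i 0 p / real N ^ i)"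
    proof (rule sum.mono_neutral_left)
      show "finite {i. 1 \<le> i \<and> i \<le> M}" by simp
      show "(\<lambda>j. 2 * j - 1) ` J \<subseteq> {i. 1 \<le> i \<and> i \<le> M}" by (auto simp: J_def)
      show "\<forall>i\<in>{i. 1 \<le> i \<and> i \<le> M} - (\<lambda>j. 2 * j - 1) ` J. log_coeff i 0 p / real N ^ i = 0"
      proof
        fix i assume i: "i \<in> {i. 1 \<le> i \<and> i \<le> M} - (\<lambda>j. 2 * j - 1) ` J"
        have "even i"
        proof (rule ccontr)
          assume "odd i"
          then obtain k where "i = 2 * k + 1" by (elim oddE)
          then have "Suc k \<in> J" and "i = 2 * Suc k - 1" using i by (auto simp: J_def)
          then show False using i by blast
        qed
        then show "log_coeff i 0 p / real N ^ i = 0" using i by (auto elim!: evenE simp: log_coeff_even)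
      qed
    qed
    finally show ?thesis by (simp add: J_def)
  qed
  have "asymp_expansion (lattice_sequentially p) (\<lambda>N. log_mad_ratio N p) (\<lambda>N k. log_coeff k 0 p) (\<lambda>k. k) \<longleftrightarrow>
    asymp_expansion (lattice_sequentially p) (\<lambda>N. log_mad_ratio N p)
      (\<lambda>N j. log_coeff (2 * j - 1) 0 p) (\<lambda>j. 2 * j - 1)"
    by (intro asymp_expansion_cong always_eventually allI odd_part)
  then show "asymp_expansion (lattice_sequentially p) (\<lambda>N. log_mad_ratio N p)
      (\<lambda>N j. log_coeff (2 * j - 1) 0 p) (\<lambda>j. 2 * j - 1)"
    using asymp_expansion_log_mad_ratio[OF assms(1,2)] by simp
next
  fix j :: nat assume "1 \<le> j"
  then show "log_coeff (2 * j - 1) 0 p = bernoulli_num (2 * j) / (real (2 * j - 1) * real (2 * j)) *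
      (1 - (p powi (1 - 2 * int j) + q powi (1 - 2 * int j)))"
    unfolding assms(3) by (rule log_coeff_odd)
  show "0 < (-1) ^ j * log_coeff (2 * j - 1) 0 p"
    using assms(1,2) \<open>1 \<le> j\<close> by (rule log_coeff_odd_sign)
qed (simp_all add: lattice_offset_eq_0 log_coeff_even)

end
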